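(* Let $m\in\mathbb{N}$, $(n_1,\dots,n_m)\in\mathbb{N}^m$, and let $E_1,\dots,E_m,F$ be Banach spaces over $\mathbb{K}$. If $T\in\mathcal{L}_s^{(n_1,\dots,n_m)}(^{n_1}E_1,\dots,{}^{n_m}E_m;F)$, then $$T\left(x_1^{(1)},\dots,x_{n_1}^{(1)},\dots,x_1^{(m)},\dots,x_{n_m}^{(m)}\right)=\frac{1}{2^{n_1+\cdots+n_m}\,n_1!\cdots n_m!}\sum_{\epsilon}\left(\prod_{k=1}^{m}\epsilon_1^{(k)}\cdots\epsilon_{n_k}^{(k)}\right)T\left(\left(x_0^{(1)}+\sum_{i=1}^{n_1}\epsilon_i^{(1)}x_i^{(1)}\right)^{n_1},\dots,\left(x_0^{(m)}+\sum_{i=1}^{n_m}\epsilon_i^{(m)}x_i^{(m)}\right)^{n_m}\right)$$ for all $x_0^{(j)},x_1^{(j)},\dots,x_{n_j}^{(j)}\in E_j$, $j=1,\dots,m$, where the outer sum runs over all choices of signs $\epsilon_i^{(k)}\in\{-1,1\}$, $1\le k\le m$, $1\le i\le n_k$.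
   Context: $\mathbb{K}=\mathbb{R}$ or $\mathbb{C}$, and $\mathbb{N}=\{1,2,\dots\}$. $\mathcal{L}(^{n_1}E_1,\dots,{}^{n_m}E_m;F)$ is the Banach space of continuous $(n_1+\cdots+n_m)$-linear mappings $T\colon E_1^{n_1}\times\cdots\times E_m^{n_m}\to F$ (the first $n_1$ variables in $E_1$, the next $n_2$ in $E_2$, etc.). Such a $T$ is $(n_1,\dots,n_m)$-symmetric if $$T\left(x_{\sigma_1(1)}^{(1)},\dots,x_{\sigma_1(n_1)}^{(1)},\dots,x_{\sigma_m(1)}^{(m)},\dots,x_{\sigma_m(n_m)}^{(m)}\right)=T\left(x_1^{(1)},\dots,x_{n_1}^{(1)},\dots,x_1^{(m)},\dots,x_{n_m}^{(m)}\right)$$ for all $x_k^{(i)}\in E_i$ and all permutations $\sigma_i\in S_{n_i}$, $i=1,\dots,m$. $\mathcal{L}_s^{(n_1,\dots,n_m)}(^{n_1}E_1,\dots,{}^{n_m}E_m;F)$ is the space of continuous $(n_1,\dots,n_m)$-symmetric mappings. The notation $T(y_1^{n_1},\dots,y_m^{n_m})$ with $y_i\in E_i$ means that $y_i$ is repeated $n_i$ times in the $n_i$ variables from $E_i$. *)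

theory Defs
  imports "HOL-Analysis.Analysis" "HOL-Algebra.Module"
begin

text \<open>
  The type classes for Banach spaces fix one type per space and carry real scalars only. Here the
  number of spaces is a variable and the scalars may be complex, so a normed space is a record
  with an explicit carrier: a \<^locale>\<open>Module.module\<close> structure together with a norm (the fields
  \<open>monoid.mult\<close> and \<open>one\<close> that the record type inherits from rings are unused). Both scalar
  fields are subfields of the complex numbers, namely \<^term>\<open>\<real> :: complex set\<close> and
  \<^term>\<open>UNIV :: complex set\<close>; over the former, nothing is required of scalar multiplication by
  non-real numbers.
\<close>

definition scalar_ring :: "complex set \<Rightarrow> complex ring" where
  "scalar_ring K = \<lparr>carrier = K, monoid.mult = (*), one = 1, zero = 0, add = (+)\<rparr>"

record 'a normed_space = "(complex, 'a) module" +
  vnorm :: "'a \<Rightarrow> real"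

text \<open>
  \<^locale>\<open>Metric_space\<close> demands nonnegativity and symmetry also off the carrier, hence the
  default value 0 there.
\<close>

definition vdist :: "'a normed_space \<Rightarrow> 'a \<Rightarrow> 'a \<Rightarrow> real" where
  "vdist E x y = (if x \<in> carrier E \<and> y \<in> carrier E then vnorm E (x \<ominus>\<^bsub>E\<^esub> y) else 0)"

definition norm_topology :: "'a normed_space \<Rightarrow> 'a topology" where
  "norm_topology E = Metric_space.mtopology (carrier E) (vdist E)"

locale banach_space = Module.module "scalar_ring K" E
  for K :: "complex set" and E :: "'a normed_space" (structure) +
  assumes vnorm_nonneg: "x \<in> carrier E \<Longrightarrow> 0 \<le> vnorm E x"
    and vnorm_eq_0: "x \<in> carrier E \<Longrightarrow> vnorm E x = 0 \<longleftrightarrow> x = \<zero>"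
    and vnorm_smult: "c \<in> K \<Longrightarrow> x \<in> carrier E \<Longrightarrow> vnorm E (c \<odot> x) = cmod c * vnorm E x"
    and vnorm_triangle:
      "x \<in> carrier E \<Longrightarrow> y \<in> carrier E \<Longrightarrow> vnorm E (x \<oplus> y) \<le> vnorm E x + vnorm E y"
    and complete: "Metric_space.mcomplete (carrier E) (vdist E)"

text \<open>
  The index \<open>(i, k)\<close> stands for the \<open>k\<close>-th of the \<open>n i\<close> variables from \<open>E i\<close>. A point of the
  product of the powers of the \<open>E i\<close> is an extensional function on these indices; the maps in
  \<open>cont_multilinear\<close> are in turn extensional on the set of these points.
\<close>

definition var_index :: "nat \<Rightarrow> (nat \<Rightarrow> nat) \<Rightarrow> (nat \<times> nat) set" where
  "var_index m n = (SIGMA i:{1..m}. {1..n i})"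

definition arg_space :: "nat \<Rightarrow> (nat \<Rightarrow> nat) \<Rightarrow> (nat \<Rightarrow> 'a normed_space) \<Rightarrow> (nat \<times> nat \<Rightarrow> 'a) set" where
  "arg_space m n E = (\<Pi>\<^sub>E (i, k)\<in>var_index m n. carrier (E i))"

definition multilinear_on ::
  "complex set \<Rightarrow> nat \<Rightarrow> (nat \<Rightarrow> nat) \<Rightarrow> (nat \<Rightarrow> 'a normed_space) \<Rightarrow> 'b normed_space \<Rightarrow>
    ((nat \<times> nat \<Rightarrow> 'a) \<Rightarrow> 'b) \<Rightarrow> bool" where
  "multilinear_on K m n E F T \<longleftrightarrow>
    (\<forall>x\<in>arg_space m n E. \<forall>(i, k)\<in>var_index m n. \<forall>a\<in>carrier (E i).
      (\<forall>b\<in>carrier (E i).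
        T (x((i, k) := a \<oplus>\<^bsub>E i\<^esub> b)) = T (x((i, k) := a)) \<oplus>\<^bsub>F\<^esub> T (x((i, k) := b))) \<and>
      (\<forall>c\<in>K. T (x((i, k) := c \<odot>\<^bsub>E i\<^esub> a)) = c \<odot>\<^bsub>F\<^esub> T (x((i, k) := a))))"

definition cont_multilinear ::
  "complex set \<Rightarrow> nat \<Rightarrow> (nat \<Rightarrow> nat) \<Rightarrow> (nat \<Rightarrow> 'a normed_space) \<Rightarrow> 'b normed_space \<Rightarrow>
    ((nat \<times> nat \<Rightarrow> 'a) \<Rightarrow> 'b) set" where
  "cont_multilinear K m n E F =
    {T \<in> arg_space m n E \<rightarrow>\<^sub>E carrier F.
      multilinear_on K m n E F T \<and>
      continuous_map (product_topology (\<lambda>(i, k). norm_topology (E i)) (var_index m n))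
        (norm_topology F) T}"

definition sym_cont_multilinear ::
  "complex set \<Rightarrow> nat \<Rightarrow> (nat \<Rightarrow> nat) \<Rightarrow> (nat \<Rightarrow> 'a normed_space) \<Rightarrow> 'b normed_space \<Rightarrow>
    ((nat \<times> nat \<Rightarrow> 'a) \<Rightarrow> 'b) set" where
  "sym_cont_multilinear K m n E F =
    {T \<in> cont_multilinear K m n E F.
      \<forall>x\<in>arg_space m n E. \<forall>\<sigma>. (\<forall>i\<in>{1..m}. \<sigma> i permutes {1..n i}) \<longrightarrow>
        T (\<lambda>(i, k)\<in>var_index m n. x (i, \<sigma> i k)) = T x}"

end

theory Submission
  imports Defs
begin

text \<open>
  Expand every argument of \<open>T\<close> by multilinearity, giving \<open>x\<^sub>0\<close> the coefficient 1. The value of \<open>T\<close>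
  at a choice \<open>f\<close> of one summand \<open>f (j, k) \<in> {0..n j}\<close> for each variable gets as coefficient a sum
  over signs, which changes sign under flipping any \<open>\<epsilon> (j, i)\<close> with \<open>i\<close> not among the values
  \<open>f (j, _)\<close>. So it vanishes unless each \<open>f (j, _)\<close> is a permutation, in which case it counts all
  sign choices and the value of \<open>T\<close> is the original one by symmetry.
\<close>

section \<open>Rearranging finite sums in an abelian monoid\<close>

lemma (in abelian_monoid) finsum_swap:
  assumes "finite A" and "\<And>a b. a \<in> A \<Longrightarrow> b \<in> B \<Longrightarrow> f a b \<in> carrier G"
  shows "(\<Oplus>a\<in>A. \<Oplus>b\<in>B. f a b) = (\<Oplus>b\<in>B. \<Oplus>a\<in>A. f a b)"
  using assms
proof (induction A rule: finite_induct)
  case empty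
  then show ?case by (simp add: finsum_zero)
next
  case (insert a A)
  have "(\<Oplus>b\<in>B. f a b \<oplus> (\<Oplus>a\<in>A. f a b)) = (\<Oplus>b\<in>B. f a b) \<oplus> (\<Oplus>b\<in>B. \<Oplus>a\<in>A. f a b)"
    using insert.prems by (intro finsum_addf) (auto intro!: finsum_closed)
  moreover have "(\<Oplus>b\<in>B. \<Oplus>a\<in>insert a A. f a b) = (\<Oplus>b\<in>B. f a b \<oplus> (\<Oplus>a\<in>A. f a b))"
    using insert by (intro finsum_cong') (auto intro!: a_closed finsum_closed finsum_insert)
  moreover have "(\<Oplus>a\<in>insert a A. \<Oplus>b\<in>B. f a b) = (\<Oplus>b\<in>B. f a b) \<oplus> (\<Oplus>a\<in>A. \<Oplus>b\<in>B. f a b)"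
    using insert by (intro finsum_insert) (auto intro!: finsum_closed)
  ultimately show ?case
    using insert by simp
qed

lemma (in abelian_monoid) finsum_Times:
  assumes "finite A" and "finite B" and "\<And>a b. a \<in> A \<Longrightarrow> b \<in> B \<Longrightarrow> f (a, b) \<in> carrier G"
  shows "(\<Oplus>p\<in>A \<times> B. f p) = (\<Oplus>a\<in>A. \<Oplus>b\<in>B. f (a, b))"
proof -
  \<comment> \<open>The product is cut into disjoint fibres over the points of \<open>A\<close>;
    each fibre is a copy of \<open>B\<close> and is reindexed by it.\<close>
  have "A \<times> B = (\<Union>a\<in>A. Pair a ` B)" by auto
  then have "(\<Oplus>p\<in>A \<times> B. f p) = (\<Oplus>a\<in>A. \<Oplus>p\<in>Pair a ` B. f p)"
    using assms add.finprod_UN_disjoint[of A "\<lambda>a. Pair a ` B" f]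
    by (auto simp: pairwise_def disjnt_def)
  also have "\<dots> = (\<Oplus>a\<in>A. \<Oplus>b\<in>B. f (a, b))"
    using assms by (intro finsum_cong' finsum_reindex) (auto intro!: finsum_closed inj_onI)
  finally show ?thesis .
qed

text \<open>A choice function on \<open>insert w W\<close> is a choice function on \<open>W\<close>
  together with a value at \<open>w\<close>. This is what lets a multilinear expansion proceed one
  variable at a time.\<close>

lemma (in abelian_monoid) finsum_PiE_insert:
  assumes "finite W" and "w \<notin> W" and "\<And>v. v \<in> insert w W \<Longrightarrow> finite (I v)"
    and f: "\<And>g. g \<in> Pi\<^sub>E (insert w W) I \<Longrightarrow> f g \<in> carrier G"
  shows "(\<Oplus>g\<in>Pi\<^sub>E (insert w W) I. f g) = (\<Oplus>g\<in>Pi\<^sub>E W I. \<Oplus>i\<in>I w. f (g(w := i)))"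
proof -
  have fin: "finite (Pi\<^sub>E W I)" "finite (I w)"
    using assms by (auto intro: finite_PiE)
  have cl: "f (g(w := i)) \<in> carrier G" if "i \<in> I w" "g \<in> Pi\<^sub>E W I" for i g
    using that by (intro f) (auto simp: PiE_insert_eq)
  have "(\<Oplus>g\<in>Pi\<^sub>E (insert w W) I. f g) = (\<Oplus>p\<in>I w \<times> Pi\<^sub>E W I. f ((\<lambda>(i, g). g(w := i)) p))"
    unfolding PiE_insert_eq using cl by (intro finsum_reindex inj_combinator \<open>w \<notin> W\<close>) auto
  also have "\<dots> = (\<Oplus>i\<in>I w. \<Oplus>g\<in>Pi\<^sub>E W I. f (g(w := i)))"
    using fin cl by (subst finsum_Times) auto
  also have "\<dots> = (\<Oplus>g\<in>Pi\<^sub>E W I. \<Oplus>i\<in>I w. f (g(w := i)))"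
    using fin cl by (intro finsum_swap)
  finally show ?thesis .
qed

section \<open>Scalars, and expansion of a multilinear map\<close>

lemma scalar_ring_simps [simp]:
  "carrier (scalar_ring K) = K" "a \<oplus>\<^bsub>scalar_ring K\<^esub> b = a + b" "a \<otimes>\<^bsub>scalar_ring K\<^esub> b = a * b"
  "\<one>\<^bsub>scalar_ring K\<^esub> = 1" "\<zero>\<^bsub>scalar_ring K\<^esub> = 0"
  by (simp_all add: scalar_ring_def)

lemma (in banach_space) prod_scalar_closed:
  "(\<And>a. a \<in> A \<Longrightarrow> f a \<in> K) \<Longrightarrow> (\<Prod>a\<in>A. f a) \<in> K"
  using R.m_closed R.one_closed by (induction A rule: infinite_finite_induct) simp_all

lemma (in banach_space) sum_scalar_closed:
  "(\<And>a. a \<in> A \<Longrightarrow> f a \<in> K) \<Longrightarrow> (\<Sum>a\<in>A. f a) \<in> K"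
  using R.a_closed R.zero_closed by (induction A rule: infinite_finite_induct) simp_all

text \<open>Serves two purposes in the theorem: collecting the coefficients of one value of
  \<open>T\<close> over all signs, and turning a sum of equal terms into a multiple of that
  term.\<close>

lemma (in banach_space) finsum_smult_rdistr:
  assumes "\<And>a. a \<in> A \<Longrightarrow> f a \<in> K" and "x \<in> carrier E" and "finite A"
  shows "(\<Oplus>a\<in>A. f a \<odot> x) = (\<Sum>a\<in>A. f a) \<odot> x"
  using assms(3,1)
proof (induction A rule: finite_induct)
  case empty
  then show ?case using smult_l_null[OF \<open>x \<in> carrier E\<close>] by simp
next
  case (insert a A)
  have "(\<Oplus>a\<in>insert a A. f a \<odot> x) = f a \<odot> x \<oplus> (\<Oplus>a\<in>A. f a \<odot> x)"
    using insert assms smult_closed by (intro M.finsum_insert) auto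
  also have "\<dots> = (f a + (\<Sum>a\<in>A. f a)) \<odot> x"
    using insert assms smult_l_distr[of "f a" "\<Sum>a\<in>A. f a" x] by (simp add: sum_scalar_closed)
  finally show ?case using insert by simp
qed

lemma arg_space_iff:
  "z \<in> arg_space m n E \<longleftrightarrow>
    (\<forall>v\<in>var_index m n. z v \<in> carrier (E (fst v))) \<and> z \<in> extensional (var_index m n)"
  by (auto simp: arg_space_def PiE_iff split: prod.splits)

lemma arg_space_upd:
  assumes "z \<in> arg_space m n E" and "w \<in> var_index m n" and "a \<in> carrier (E (fst w))"
  shows "z(w := a) \<in> arg_space m n E"
  using assms by (auto simp: arg_space_def PiE_iff extensional_def split: prod.splits)

lemma multilinear_on_finsum:
  assumes E: "\<And>j. j \<in> {1..m} \<Longrightarrow> banach_space K (E j)" and F: "banach_space K F"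
    and T: "T \<in> arg_space m n E \<rightarrow> carrier F" and ml: "multilinear_on K m n E F T"
    and z: "z \<in> arg_space m n E" and w: "w \<in> var_index m n" and "finite I"
    and c: "\<And>i. i \<in> I \<Longrightarrow> c i \<in> K" and y: "\<And>i. i \<in> I \<Longrightarrow> y i \<in> carrier (E (fst w))"
  shows "T (z(w := \<Oplus>\<^bsub>E (fst w)\<^esub>i\<in>I. c i \<odot>\<^bsub>E (fst w)\<^esub> y i)) = (\<Oplus>\<^bsub>F\<^esub>i\<in>I. c i \<odot>\<^bsub>F\<^esub> T (z(w := y i)))"
  using \<open>finite I\<close> c y
proof (induction I rule: finite_induct)
  interpret F: banach_space K F by (fact F)
  let ?E = "E (fst w)"
  interpret E: banach_space K ?E using w E by (auto simp: var_index_def)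
  have Tz: "T (z(w := a)) \<in> carrier F" if "a \<in> carrier ?E" for a
    using T arg_space_upd[OF z w that] by auto
  have add: "T (z(w := a \<oplus>\<^bsub>?E\<^esub> b)) = T (z(w := a)) \<oplus>\<^bsub>F\<^esub> T (z(w := b))"
    if "a \<in> carrier ?E" "b \<in> carrier ?E" for a b
    using ml z w that unfolding multilinear_on_def by (cases w) fastforce
  have scale: "T (z(w := c \<odot>\<^bsub>?E\<^esub> a)) = c \<odot>\<^bsub>F\<^esub> T (z(w := a))"
    if "a \<in> carrier ?E" "c \<in> K" for a c
    using ml z w that unfolding multilinear_on_def by (cases w) fastforce
  {
    case empty
    \<comment> \<open>Writing the zero vector as 0 times itself lets homogeneity show that
      \<open>T\<close> vanishes when one argument is zero.\<close>
    have "T (z(w := \<zero>\<^bsub>?E\<^esub>)) = T (z(w := 0 \<odot>\<^bsub>?E\<^esub> \<zero>\<^bsub>?E\<^esub>))"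
      using E.smult_l_null[of "\<zero>\<^bsub>?E\<^esub>"] by simp
    also have "\<dots> = 0 \<odot>\<^bsub>F\<^esub> T (z(w := \<zero>\<^bsub>?E\<^esub>))"
      using F.R.zero_closed by (intro scale) auto
    also have "\<dots> = \<zero>\<^bsub>F\<^esub>"
      using F.smult_l_null[OF Tz[of "\<zero>\<^bsub>?E\<^esub>"]] by simp
    finally show ?case by (simp add: fun_upd_def)
  next
    case (insert i I)
    have cl: "c k \<odot>\<^bsub>?E\<^esub> y k \<in> carrier ?E" "c k \<odot>\<^bsub>F\<^esub> T (z(w := y k)) \<in> carrier F"
      if "k \<in> insert i I" for k
      using that insert.prems E.smult_closed F.smult_closed Tz by auto
    have "T (z(w := \<Oplus>\<^bsub>?E\<^esub>i\<in>insert i I. c i \<odot>\<^bsub>?E\<^esub> y i)) =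
        T (z(w := c i \<odot>\<^bsub>?E\<^esub> y i)) \<oplus>\<^bsub>F\<^esub> T (z(w := \<Oplus>\<^bsub>?E\<^esub>i\<in>I. c i \<odot>\<^bsub>?E\<^esub> y i))"
      using insert cl by (subst E.M.finsum_insert) (auto intro!: add E.M.finsum_closed)
    also have "\<dots> = c i \<odot>\<^bsub>F\<^esub> T (z(w := y i)) \<oplus>\<^bsub>F\<^esub> (\<Oplus>\<^bsub>F\<^esub>i\<in>I. c i \<odot>\<^bsub>F\<^esub> T (z(w := y i)))"
      using insert by (simp add: scale[unfolded fun_upd_def] fun_upd_def)
    also have "\<dots> = (\<Oplus>\<^bsub>F\<^esub>i\<in>insert i I. c i \<odot>\<^bsub>F\<^esub> T (z(w := y i)))"
      using insert.hyps cl by (subst F.M.finsum_insert) auto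
    finally show ?case .
  }
qed

text \<open>Induction on the set \<open>W\<close> of expanded variables, the others being held at
  \<open>z\<close>. The point \<open>z\<close> has to be arbitrary: the step stores the whole sum
  for the new variable \<open>w\<close> in \<open>z\<close>, expands over \<open>W\<close> by the
  induction hypothesis, and only then splits slot \<open>w\<close> by
  \<open>multilinear_on_finsum\<close>.\<close>

lemma multilinear_on_expand:
  fixes T :: "(nat \<times> nat \<Rightarrow> 'a) \<Rightarrow> 'b"
  assumes E: "\<And>j. j \<in> {1..m} \<Longrightarrow> banach_space K (E j)" and F: "banach_space K F"
    and T: "T \<in> arg_space m n E \<rightarrow> carrier F" and ml: "multilinear_on K m n E F T"
    and "finite W" and "W \<subseteq> var_index m n" and z: "z \<in> arg_space m n E"
    and I: "\<And>v. v \<in> W \<Longrightarrow> finite (I v)"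
    and c: "\<And>v i. v \<in> W \<Longrightarrow> i \<in> I v \<Longrightarrow> c v i \<in> K"
    and y: "\<And>v i. v \<in> W \<Longrightarrow> i \<in> I v \<Longrightarrow> y v i \<in> carrier (E (fst v))"
  shows "T (\<lambda>v. if v \<in> W then \<Oplus>\<^bsub>E (fst v)\<^esub>i\<in>I v. c v i \<odot>\<^bsub>E (fst v)\<^esub> y v i else z v) =
    (\<Oplus>\<^bsub>F\<^esub>f\<in>Pi\<^sub>E W I. (\<Prod>v\<in>W. c v (f v)) \<odot>\<^bsub>F\<^esub> T (\<lambda>v. if v \<in> W then y v (f v) else z v))"
  using assms(5-)
proof (induction W arbitrary: z rule: finite_induct)
  interpret F: banach_space K F by (fact F)
  {
    case (empty z)
    then have "T z \<in> carrier F" using T by auto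
    then show ?case using F.smult_one[of "T z"] by simp
  next
    case (insert w W z)
    let ?E = "E (fst w)"
    have w: "w \<in> var_index m n" and W: "W \<subseteq> var_index m n" using insert.prems by auto
    interpret E: banach_space K ?E using w E by (auto simp: var_index_def)
    have csum: "(\<Oplus>\<^bsub>?E\<^esub>i\<in>I w. c w i \<odot>\<^bsub>?E\<^esub> y w i) \<in> carrier ?E"
      using insert.prems E.smult_closed by (intro E.M.finsum_closed) auto
    \<comment> \<open>Since \<open>w\<close> is not in \<open>W\<close>, the substitution
      \<open>s f\<close> commutes with an update at \<open>w\<close>; hence slot \<open>w\<close>
      stays free for the one-variable expansion.\<close>
    define s where "s f z = (\<lambda>v. if v \<in> W then y v (f v) else z v)" for f and z :: "nat \<times> nat \<Rightarrow> 'a"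
    have s: "s f z \<in> arg_space m n E" if "f \<in> Pi\<^sub>E W I" "z \<in> arg_space m n E" for f z
      using that W insert.prems(5)[OF insertI2 PiE_mem[OF that(1)]]
      by (auto simp: s_def arg_space_iff extensional_def)
    have s_upd: "s f (z(w := a)) = (s f z)(w := a)" for f z a
      using insert.hyps by (auto simp: s_def)
    have s_insert: "(\<lambda>v. if v \<in> insert w W then y v ((f(w := i)) v) else z v) = (s f z)(w := y w i)" for f i z
      using insert.hyps by (auto simp: s_def)
    have C: "(\<Prod>v\<in>W. c v (f v)) \<in> K" if "f \<in> Pi\<^sub>E W I" for f
      using insert.prems(4)[OF insertI2 PiE_mem[OF that]] by (auto intro: F.prod_scalar_closed)
    have Ts: "T ((s f z)(w := y w i)) \<in> carrier F" if "f \<in> Pi\<^sub>E W I" "i \<in> I w" for f i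
      using T arg_space_upd[OF s w insert.prems(5)] that insert.prems(2) by auto
    have prod_insert: "(\<Prod>v\<in>insert w W. c v ((f(w := i)) v)) = (\<Prod>v\<in>W. c v (f v)) * c w i" for f i
    proof -
      have "(\<Prod>v\<in>W. c v ((f(w := i)) v)) = (\<Prod>v\<in>W. c v (f v))"
        using insert.hyps by (intro prod.cong) auto
      then show ?thesis using insert.hyps by simp
    qed
    have step: "(\<Prod>v\<in>W. c v (f v)) \<odot>\<^bsub>F\<^esub> T (s f (z(w := \<Oplus>\<^bsub>?E\<^esub>i\<in>I w. c w i \<odot>\<^bsub>?E\<^esub> y w i))) =
        (\<Oplus>\<^bsub>F\<^esub>i\<in>I w. ((\<Prod>v\<in>W. c v (f v)) * c w i) \<odot>\<^bsub>F\<^esub> T ((s f z)(w := y w i)))"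
      if f: "f \<in> Pi\<^sub>E W I" for f
    proof -
      have "T (s f (z(w := \<Oplus>\<^bsub>?E\<^esub>i\<in>I w. c w i \<odot>\<^bsub>?E\<^esub> y w i))) =
          (\<Oplus>\<^bsub>F\<^esub>i\<in>I w. c w i \<odot>\<^bsub>F\<^esub> T ((s f z)(w := y w i)))"
        unfolding s_upd using insert.prems
        by (intro multilinear_on_finsum[OF E F T ml s[OF f] w]) auto
      then have "(\<Prod>v\<in>W. c v (f v)) \<odot>\<^bsub>F\<^esub> T (s f (z(w := \<Oplus>\<^bsub>?E\<^esub>i\<in>I w. c w i \<odot>\<^bsub>?E\<^esub> y w i))) =
        (\<Oplus>\<^bsub>F\<^esub>i\<in>I w. (\<Prod>v\<in>W. c v (f v)) \<odot>\<^bsub>F\<^esub> (c w i \<odot>\<^bsub>F\<^esub> T ((s f z)(w := y w i))))"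
        using insert.prems C[OF f] Ts[OF f] F.smult_closed
        by (simp add: F.finsum_smult_ldistr Pi_def)
      also have "\<dots> = (\<Oplus>\<^bsub>F\<^esub>i\<in>I w. ((\<Prod>v\<in>W. c v (f v)) * c w i) \<odot>\<^bsub>F\<^esub> T ((s f z)(w := y w i)))"
        using insert.prems C[OF f] Ts[OF f] F.smult_closed F.smult_assoc1 F.R.m_closed
        by (intro F.M.finsum_cong') auto
      finally show ?thesis .
    qed
    \<comment> \<open>The closure condition of \<open>finsum_PiE_insert\<close>, obtained by
      splitting \<open>g\<close> into its restriction to \<open>W\<close> and its value at
      \<open>w\<close>.\<close>
    have summand: "(\<Prod>v\<in>insert w W. c v (g v)) \<odot>\<^bsub>F\<^esub>
        T (\<lambda>v. if v \<in> insert w W then y v (g v) else z v) \<in> carrier F"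
      if g_in: "g \<in> Pi\<^sub>E (insert w W) I" for g
    proof -
      obtain f i where g: "g = f(w := i)" and fi: "f \<in> Pi\<^sub>E W I" "i \<in> I w"
        using g_in by (auto simp: PiE_insert_eq)
      show ?thesis
        unfolding g s_insert prod_insert
        using fi C Ts F.smult_closed F.R.m_closed insert.prems(4) by auto
    qed
    \<comment> \<open>The sum in slot \<open>w\<close> now counts as part of the base point, so that
      the induction hypothesis applies to \<open>W\<close>.\<close>
    have "T (\<lambda>v. if v \<in> insert w W then \<Oplus>\<^bsub>E (fst v)\<^esub>i\<in>I v. c v i \<odot>\<^bsub>E (fst v)\<^esub> y v i else z v) =
        T (\<lambda>v. if v \<in> W then \<Oplus>\<^bsub>E (fst v)\<^esub>i\<in>I v. c v i \<odot>\<^bsub>E (fst v)\<^esub> y v i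
             else (z(w := \<Oplus>\<^bsub>?E\<^esub>i\<in>I w. c w i \<odot>\<^bsub>?E\<^esub> y w i)) v)"
      using insert.hyps by (intro arg_cong[of _ _ T]) auto
    also have "\<dots> = (\<Oplus>\<^bsub>F\<^esub>f\<in>Pi\<^sub>E W I. (\<Prod>v\<in>W. c v (f v)) \<odot>\<^bsub>F\<^esub>
        T (s f (z(w := \<Oplus>\<^bsub>?E\<^esub>i\<in>I w. c w i \<odot>\<^bsub>?E\<^esub> y w i))))"
      unfolding s_def using insert.prems w csum by (intro insert.IH arg_space_upd) auto
    also have "\<dots> = (\<Oplus>\<^bsub>F\<^esub>f\<in>Pi\<^sub>E W I. \<Oplus>\<^bsub>F\<^esub>i\<in>I w.
        ((\<Prod>v\<in>W. c v (f v)) * c w i) \<odot>\<^bsub>F\<^esub> T ((s f z)(w := y w i)))"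
      using insert.prems C Ts F.smult_closed F.R.m_closed step
      by (intro F.M.finsum_cong') (auto intro!: F.M.finsum_closed)
    also have "\<dots> = (\<Oplus>\<^bsub>F\<^esub>f\<in>Pi\<^sub>E (insert w W) I. (\<Prod>v\<in>insert w W. c v (f v)) \<odot>\<^bsub>F\<^esub>
        T (\<lambda>v. if v \<in> insert w W then y v (f v) else z v))"
      by (subst F.M.finsum_PiE_insert[OF insert.hyps(1,2) insert.prems(3) summand])
        (simp_all only: s_insert prod_insert)
    finally show ?case .
  }
qed

section \<open>Sums of products of signs\<close>

lemma sum_prod_signs_eq_0:
  assumes "finite V" and "w \<in> V" and "w \<notin> g ` U"
  shows "(\<Sum>\<epsilon>\<in>V \<rightarrow>\<^sub>E {-1, 1 :: complex}. (\<Prod>v\<in>V. \<epsilon> v) * (\<Prod>u\<in>U. \<epsilon> (g u))) = 0"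
\<comment> \<open>Flipping the sign at \<open>w\<close> negates the product over \<open>V\<close>
  and leaves the other product alone, because \<open>g\<close> misses \<open>w\<close> on
  \<open>U\<close>. The summands therefore cancel in pairs.\<close>
proof (rule sum_involution_eq_0[where h = "\<lambda>\<epsilon>. \<epsilon>(w := - \<epsilon> w)"])
  fix \<epsilon> :: "'a \<Rightarrow> complex" assume \<epsilon>: "\<epsilon> \<in> V \<rightarrow>\<^sub>E {-1, 1}"
  have "(\<Prod>u\<in>U. (\<epsilon>(w := - \<epsilon> w)) (g u)) = (\<Prod>u\<in>U. \<epsilon> (g u))"
    using assms by (intro prod.cong) auto
  moreover have "(\<Prod>v\<in>V - {w}. (\<epsilon>(w := - \<epsilon> w)) v) = (\<Prod>v\<in>V - {w}. \<epsilon> v)"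
    by (intro prod.cong) auto
  ultimately show "(\<Prod>v\<in>V. (\<epsilon>(w := - \<epsilon> w)) v) * (\<Prod>u\<in>U. (\<epsilon>(w := - \<epsilon> w)) (g u)) +
      (\<Prod>v\<in>V. \<epsilon> v) * (\<Prod>u\<in>U. \<epsilon> (g u)) = 0"
    using prod.remove[OF assms(1,2), of "\<epsilon>(w := - \<epsilon> w)"] prod.remove[OF assms(1,2), of \<epsilon>] by simp
  show "\<epsilon>(w := - \<epsilon> w) \<in> V \<rightarrow>\<^sub>E {-1, 1}"
    using \<epsilon> \<open>w \<in> V\<close> by (fastforce simp: PiE_iff extensional_def)
  have "\<epsilon> w \<in> {-1, 1}" using \<epsilon> \<open>w \<in> V\<close> by auto
  \<comment> \<open>The flip has no fixed point, as a sign is never 0.\<close>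
  then have "- \<epsilon> w \<noteq> \<epsilon> w" by auto
  then show "\<epsilon>(w := - \<epsilon> w) \<noteq> \<epsilon>" by (metis fun_upd_same)
qed simp

text \<open>Reindexing by \<open>g\<close> makes the two products equal, so each summand is a
  product of squares of signs, that is 1, and the sum counts the sign choices.\<close>

lemma sum_prod_signs_bij:
  assumes "finite V" and "bij_betw g V V"
  shows "(\<Sum>\<epsilon>\<in>V \<rightarrow>\<^sub>E {-1, 1 :: complex}. (\<Prod>v\<in>V. \<epsilon> v) * (\<Prod>v\<in>V. \<epsilon> (g v))) = 2 ^ card V"
proof -
  have "(\<Prod>v\<in>V. \<epsilon> v) * (\<Prod>v\<in>V. \<epsilon> (g v)) = 1" if "\<epsilon> \<in> V \<rightarrow>\<^sub>E {-1, 1 :: complex}" for \<epsilon>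
  proof -
    have "(\<Prod>v\<in>V. \<epsilon> v) * (\<Prod>v\<in>V. \<epsilon> (g v)) = (\<Prod>v\<in>V. \<epsilon> v * \<epsilon> v)"
      using prod.reindex_bij_betw[OF assms(2), of \<epsilon>] by (simp add: prod.distrib)
    also have "\<dots> = 1"
      using that by (intro prod.neutral) (auto simp: PiE_iff)
    finally show ?thesis .
  qed
  then show ?thesis
    using assms(1) by (simp add: card_PiE numeral_2_eq_2)
qed

section \<open>Choice functions that permute each block of variables\<close>

lemma finite_var_index [simp]: "finite (var_index m n)"
  by (simp add: var_index_def)

lemma card_var_index: "card (var_index m n) = (\<Sum>j=1..m. n j)"
  by (simp add: var_index_def)

text \<open>Converts a family of permutations, one for each space, into the form that indexes the
  expansion: an extensional function naming the summand picked in each variable.\<close>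

definition blockwise :: "nat \<Rightarrow> (nat \<Rightarrow> nat) \<Rightarrow> (nat \<Rightarrow> nat \<Rightarrow> nat) \<Rightarrow> nat \<times> nat \<Rightarrow> nat" where
  "blockwise m n \<sigma> = (\<lambda>(j, k)\<in>var_index m n. \<sigma> j k)"

lemma inj_on_blockwise:
  "inj_on (blockwise m n) (\<Pi>\<^sub>E j\<in>{1..m}. {p. p permutes {1..n j}})"
proof (rule inj_onI)
  fix \<sigma> \<tau>
  assume \<sigma>: "\<sigma> \<in> (\<Pi>\<^sub>E j\<in>{1..m}. {p. p permutes {1..n j}})"
    and \<tau>: "\<tau> \<in> (\<Pi>\<^sub>E j\<in>{1..m}. {p. p permutes {1..n j}})"
    and eq: "blockwise m n \<sigma> = blockwise m n \<tau>"
  show "\<sigma> = \<tau>"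
  proof (rule PiE_ext[OF \<sigma> \<tau>])
    fix j assume j: "j \<in> {1..m}"
    show "\<sigma> j = \<tau> j"
    proof
      fix k
      show "\<sigma> j k = \<tau> j k"
      proof (cases "k \<in> {1..n j}")
        case True
        then show ?thesis
          using j fun_cong[OF eq, of "(j, k)"] by (auto simp: blockwise_def var_index_def)
      next
        \<comment> \<open>Such a \<open>k\<close> is invisible to \<open>blockwise\<close>, but
          permutations of the block fix it.\<close>
        case False
        then show ?thesis
          using PiE_mem[OF \<sigma> j] PiE_mem[OF \<tau> j] permutes_not_in[OF _ False]
          by (metis mem_Collect_eq)
      qed
    qed
  qed
qed

text \<open>The map sends a variable to the index of the sign attached to its chosen summand. It is
  an injection of a finite set into itself; the result feeds
  \<open>sum_prod_signs_bij\<close>.\<close>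

lemma bij_betw_blockwise:
  assumes "\<And>j. j \<in> {1..m} \<Longrightarrow> \<sigma> j permutes {1..n j}"
  shows "bij_betw (\<lambda>v. (fst v, blockwise m n \<sigma> v)) (var_index m n) (var_index m n)"
proof -
  let ?g = "\<lambda>v. (fst v, blockwise m n \<sigma> v)"
  have "inj_on ?g (var_index m n)"
    using permutes_inj[OF assms] by (auto intro!: inj_onI simp: blockwise_def var_index_def inj_eq)
  moreover have "?g ` var_index m n \<subseteq> var_index m n"
    using permutes_in_image[OF assms] by (force simp: blockwise_def var_index_def)
  ultimately show ?thesis
    by (simp add: bij_betw_def endo_inj_surj)
qed

text \<open>The map keeps the first coordinate, so its surjectivity splits into surjectivity within
  each block, and onto a set of the same finite size this means bijectivity. Contraposed, a choice
  that is not blockwise a permutation misses some sign index.\<close>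

lemma blockwise_if_surj:
  assumes f: "f \<in> extensional (var_index m n)"
    and surj: "var_index m n \<subseteq> (\<lambda>v. (fst v, f v)) ` var_index m n"
  shows "f \<in> blockwise m n ` (\<Pi>\<^sub>E j\<in>{1..m}. {p. p permutes {1..n j}})"
proof -
  \<comment> \<open>The identity outside the block is what \<open>permutes\<close> demands.\<close>
  define \<sigma> where "\<sigma> = (\<lambda>j\<in>{1..m}. \<lambda>k. if k \<in> {1..n j} then f (j, k) else k)"
  have "\<sigma> j permutes {1..n j}" if j: "j \<in> {1..m}" for j
  proof (rule bij_imp_permutes)
    have sub: "{1..n j} \<subseteq> (\<lambda>k. f (j, k)) ` {1..n j}"
    proof
      fix i assume "i \<in> {1..n j}"
      then have "(j, i) \<in> (\<lambda>v. (fst v, f v)) ` var_index m n"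
        using j surj by (auto simp: var_index_def)
      then show "i \<in> (\<lambda>k. f (j, k)) ` {1..n j}"
        by (auto simp: var_index_def)
    qed
    \<comment> \<open>The image contains the block and has at most \<open>n j\<close> elements. This
      also excludes the value 0, which stands for the summand \<open>x j 0\<close>.\<close>
    have "(\<lambda>k. f (j, k)) ` {1..n j} = {1..n j}"
      using card_seteq[OF _ sub] card_image_le[of "{1..n j}" "\<lambda>k. f (j, k)"] by simp
    then have "bij_betw (\<lambda>k. f (j, k)) {1..n j} {1..n j}"
      by (simp add: bij_betw_def finite_surj_inj)
    then show "bij_betw (\<sigma> j) {1..n j} {1..n j}"
      using j by (subst bij_betw_cong[of _ _ "\<lambda>k. f (j, k)"]) (auto simp: \<sigma>_def)
    show "\<sigma> j k = k" if "k \<notin> {1..n j}" for k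
      using j that by (auto simp: \<sigma>_def)
  qed
  then have "\<sigma> \<in> (\<Pi>\<^sub>E j\<in>{1..m}. {p. p permutes {1..n j}})"
    by (auto simp: \<sigma>_def)
  moreover have "f = blockwise m n \<sigma>"
    using f by (auto simp: blockwise_def \<sigma>_def var_index_def extensional_def fun_eq_iff restrict_def)
  ultimately show ?thesis by blast
qed

section \<open>Summing the expansions over all sign choices\<close>

theorem theorem2p8:
  fixes K :: "complex set" and m :: nat and n :: "nat \<Rightarrow> nat"
    and E :: "nat \<Rightarrow> 'a normed_space" and F :: "'b normed_space"
    and T :: "(nat \<times> nat \<Rightarrow> 'a) \<Rightarrow> 'b" and x :: "nat \<Rightarrow> nat \<Rightarrow> 'a"
  assumes "K = \<real> \<or> K = UNIV"
    and "1 \<le> m"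
    and "\<And>j. j \<in> {1..m} \<Longrightarrow> 1 \<le> n j"
    and "\<And>j. j \<in> {1..m} \<Longrightarrow> banach_space K (E j)"
    and "banach_space K F"
    and "T \<in> sym_cont_multilinear K m n E F"
    and "\<And>j i. j \<in> {1..m} \<Longrightarrow> i \<in> {0..n j} \<Longrightarrow> x j i \<in> carrier (E j)"
  shows "T (\<lambda>(j, i)\<in>var_index m n. x j i) =
    (1 / (2 ^ (\<Sum>j=1..m. n j) * (\<Prod>j=1..m. fact (n j)))) \<odot>\<^bsub>F\<^esub>
      (\<Oplus>\<^bsub>F\<^esub>\<epsilon>\<in>var_index m n \<rightarrow>\<^sub>E {-1, 1}.
        (\<Prod>k=1..m. \<Prod>i=1..n k. \<epsilon> (k, i)) \<odot>\<^bsub>F\<^esub>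
        T (\<lambda>(j, _)\<in>var_index m n.
             x j 0 \<oplus>\<^bsub>E j\<^esub> (\<Oplus>\<^bsub>E j\<^esub>i\<in>{1..n j}. \<epsilon> (j, i) \<odot>\<^bsub>E j\<^esub> x j i)))"
proof -
  note E = assms(4) and F = assms(5) and x = assms(7)
  interpret F: banach_space K F by (fact F)
  let ?V = "var_index m n"
  define S where "S = (?V \<rightarrow>\<^sub>E {-1, 1 :: complex})"
  define X where "X = (\<lambda>(j, i)\<in>?V. x j i)"
  define I where "I v = {0..n (fst v)}" for v :: "nat \<times> nat"
  \<comment> \<open>With coefficient 1 at index 0, each argument of \<open>T\<close> becomes one
    linear combination over {0..n j}, the same for all variables of block \<open>j\<close>.\<close>
  define c where "c \<epsilon> v i = (if i = 0 then 1 else \<epsilon> (fst v, i))"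
    for \<epsilon> :: "nat \<times> nat \<Rightarrow> complex" and v :: "nat \<times> nat" and i :: nat
  define A where "A = Pi\<^sub>E ?V I"
  define a where "a f = T (\<lambda>v. if v \<in> ?V then x (fst v) (f v) else X v)" for f
  define s where "s \<epsilon> = (\<Prod>v\<in>?V. \<epsilon> v)" for \<epsilon> :: "nat \<times> nat \<Rightarrow> complex"
  define C where "C \<epsilon> f = (\<Prod>v\<in>?V. c \<epsilon> v (f v))" for \<epsilon> f
  define G where "G = (\<Pi>\<^sub>E j\<in>{1..m}. {p. p permutes {1..n j}})"
  have T: "T \<in> arg_space m n E \<rightarrow> carrier F" and ml: "multilinear_on K m n E F T"
    and T_sym: "\<And>z \<sigma>. z \<in> arg_space m n E \<Longrightarrow> (\<And>j. j \<in> {1..m} \<Longrightarrow> \<sigma> j permutes {1..n j}) \<Longrightarrow>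
        T (\<lambda>(j, k)\<in>?V. z (j, \<sigma> j k)) = T z"
    using assms(6) by (auto simp: sym_cont_multilinear_def cont_multilinear_def)
  have X: "X \<in> arg_space m n E"
    using x by (auto simp: X_def arg_space_def var_index_def)
  have TX: "T X \<in> carrier F"
    using T X by auto
  have fin: "finite S" "finite A" "finite G"
    by (auto simp: S_def A_def I_def G_def finite_permutations intro!: finite_PiE)
  have K_1: "1 \<in> K" "-1 \<in> K"
    using assms(1) by auto
  have cK: "c \<epsilon> v i \<in> K" if "\<epsilon> \<in> S" "v \<in> ?V" "i \<in> I v" for \<epsilon> v i
  proof -
    have "\<epsilon> w \<in> K" if "w \<in> ?V" for w
      using PiE_mem[OF \<open>\<epsilon> \<in> S\<close>[unfolded S_def] that] K_1 by auto
    then show ?thesis using that K_1 by (auto simp: c_def I_def var_index_def)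
  qed
  have sK: "s \<epsilon> \<in> K" if "\<epsilon> \<in> S" for \<epsilon>
    unfolding s_def using that K_1 by (intro F.prod_scalar_closed) (fastforce simp: S_def PiE_iff)
  have CK: "C \<epsilon> f \<in> K" if "\<epsilon> \<in> S" "f \<in> A" for \<epsilon> f
    unfolding C_def
    by (rule F.prod_scalar_closed, rule cK[OF that(1)])
      (auto intro: PiE_mem[OF that(2)[unfolded A_def]])
  have sCK: "s \<epsilon> * C \<epsilon> f \<in> K" if "\<epsilon> \<in> S" "f \<in> A" for \<epsilon> f
    using F.R.m_closed sK CK that by simp
  have aF: "a f \<in> carrier F" if "f \<in> A" for f
  proof -
    have "(\<lambda>v. if v \<in> ?V then x (fst v) (f v) else X v) \<in> arg_space m n E"
      using that X x by (fastforce simp: A_def I_def arg_space_def PiE_iff extensional_def var_index_def)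
    then show ?thesis using T by (auto simp: a_def)
  qed
  have s_eq: "(\<Prod>k=1..m. \<Prod>i=1..n k. \<epsilon> (k, i)) = s \<epsilon>" for \<epsilon>
    unfolding s_def var_index_def by (subst prod.Sigma) auto
  have expand: "T (\<lambda>(j, _)\<in>?V. x j 0 \<oplus>\<^bsub>E j\<^esub> (\<Oplus>\<^bsub>E j\<^esub>i\<in>{1..n j}. \<epsilon> (j, i) \<odot>\<^bsub>E j\<^esub> x j i)) =
      (\<Oplus>\<^bsub>F\<^esub>f\<in>A. C \<epsilon> f \<odot>\<^bsub>F\<^esub> a f)" if \<epsilon>: "\<epsilon> \<in> S" for \<epsilon>
  proof -
    have "x j 0 \<oplus>\<^bsub>E j\<^esub> (\<Oplus>\<^bsub>E j\<^esub>i\<in>{1..n j}. \<epsilon> (j, i) \<odot>\<^bsub>E j\<^esub> x j i) =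
        (\<Oplus>\<^bsub>E j\<^esub>i\<in>I (j, k). c \<epsilon> (j, k) i \<odot>\<^bsub>E j\<^esub> x j i)" if "(j, k) \<in> ?V" for j k
    proof -
      have j: "j \<in> {1..m}" using that by (auto simp: var_index_def)
      interpret E: banach_space K "E j" by (rule E[OF j])
      have cl: "c \<epsilon> (j, k) i \<odot>\<^bsub>E j\<^esub> x j i \<in> carrier (E j)" if "i \<in> I (j, k)" for i
        using cK[OF \<epsilon> \<open>(j, k) \<in> ?V\<close> that] x[OF j, of i] that E.smult_closed by (auto simp: I_def)
      have "I (j, k) = insert 0 {1..n j}" by (auto simp: I_def)
      then have "(\<Oplus>\<^bsub>E j\<^esub>i\<in>I (j, k). c \<epsilon> (j, k) i \<odot>\<^bsub>E j\<^esub> x j i) =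
          c \<epsilon> (j, k) 0 \<odot>\<^bsub>E j\<^esub> x j 0 \<oplus>\<^bsub>E j\<^esub> (\<Oplus>\<^bsub>E j\<^esub>i\<in>{1..n j}. c \<epsilon> (j, k) i \<odot>\<^bsub>E j\<^esub> x j i)"
        using cl by (simp add: E.M.finsum_insert Pi_def)
      also have "c \<epsilon> (j, k) 0 \<odot>\<^bsub>E j\<^esub> x j 0 = x j 0"
        using x[OF j, of 0] E.smult_one[of "x j 0"] by (simp add: c_def)
      also have "(\<Oplus>\<^bsub>E j\<^esub>i\<in>{1..n j}. c \<epsilon> (j, k) i \<odot>\<^bsub>E j\<^esub> x j i) =
          (\<Oplus>\<^bsub>E j\<^esub>i\<in>{1..n j}. \<epsilon> (j, i) \<odot>\<^bsub>E j\<^esub> x j i)"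
      proof (rule E.M.finsum_cong'[OF refl, symmetric])
        show "(\<lambda>i. c \<epsilon> (j, k) i \<odot>\<^bsub>E j\<^esub> x j i) \<in> {1..n j} \<rightarrow> carrier (E j)"
          using cl by (auto simp: I_def)
      qed (auto simp: c_def)
      finally show ?thesis by simp
    qed
    \<comment> \<open>Every variable is expanded, so the base point \<open>X\<close> is read only
      off \<open>?V\<close>, where it supplies the default value of an extensional function.\<close>
    then have eq: "(\<lambda>(j, _)\<in>?V. x j 0 \<oplus>\<^bsub>E j\<^esub> (\<Oplus>\<^bsub>E j\<^esub>i\<in>{1..n j}. \<epsilon> (j, i) \<odot>\<^bsub>E j\<^esub> x j i)) =
        (\<lambda>v. if v \<in> ?V then \<Oplus>\<^bsub>E (fst v)\<^esub>i\<in>I v. c \<epsilon> v i \<odot>\<^bsub>E (fst v)\<^esub> x (fst v) i else X v)"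
      by (auto simp: fun_eq_iff X_def)
    show ?thesis
      unfolding eq A_def C_def a_def using cK[OF \<epsilon>] x
      by (intro multilinear_on_expand[OF E F T ml finite_var_index subset_refl X])
        (auto simp: I_def var_index_def)
  qed
  have coeff: "(\<Sum>\<epsilon>\<in>S. s \<epsilon> * C \<epsilon> f) =
      (if f \<in> blockwise m n ` G then 2 ^ (\<Sum>j=1..m. n j) else 0)" if "f \<in> A" for f
  proof -
    \<comment> \<open>Only variables whose choice is not \<open>x j 0\<close> contribute a sign to
      \<open>C\<close>.\<close>
    define U where "U = {v \<in> ?V. f v \<noteq> 0}"
    have C_eq: "C \<epsilon> f = (\<Prod>v\<in>U. \<epsilon> (fst v, f v))" for \<epsilon>
      unfolding C_def U_def c_def by (intro prod.mono_neutral_cong_right) auto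
    show ?thesis
    proof (cases "f \<in> blockwise m n ` G")
      case True
      then obtain \<sigma> where f: "f = blockwise m n \<sigma>" and "\<sigma> \<in> G"
        by blast
      then have \<sigma>: "\<And>j. j \<in> {1..m} \<Longrightarrow> \<sigma> j permutes {1..n j}"
        by (auto simp: G_def)
      note bij = bij_betw_blockwise[of m \<sigma> n, OF \<sigma>, folded f]
      \<comment> \<open>A permutation of {1..n j} never takes the value 0.\<close>
      have "U = ?V"
        using bij_betwE[OF bij] by (force simp: U_def var_index_def)
      then show ?thesis
        using True sum_prod_signs_bij[OF finite_var_index bij]
        by (simp add: C_eq s_def S_def card_var_index)
    next
      case False
      then obtain w where w: "w \<in> ?V" "w \<notin> (\<lambda>v. (fst v, f v)) ` ?V"
        using blockwise_if_surj[of f m n, folded G_def] \<open>f \<in> A\<close>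
        unfolding A_def PiE_iff by blast
      then have "w \<notin> (\<lambda>v. (fst v, f v)) ` U" by (auto simp: U_def)
      then show ?thesis
        using False sum_prod_signs_eq_0[OF finite_var_index w(1)]
        by (simp add: C_eq s_def S_def)
    qed
  qed
  have GA: "blockwise m n ` G \<subseteq> A"
  proof
    fix f assume "f \<in> blockwise m n ` G"
    then obtain \<sigma> where f: "f = blockwise m n \<sigma>" and "\<sigma> \<in> G"
      by blast
    then have \<sigma>: "\<And>j. j \<in> {1..m} \<Longrightarrow> \<sigma> j permutes {1..n j}"
      by (auto simp: G_def)
    show "f \<in> A"
      unfolding f using permutes_in_image[OF \<sigma>] by (force simp: A_def I_def blockwise_def var_index_def)
  qed
  have a_blockwise: "a f = T X" if f_in: "f \<in> blockwise m n ` G" for f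
  proof -
    obtain \<sigma> where f: "f = blockwise m n \<sigma>" and "\<sigma> \<in> G"
      using f_in by blast
    then have \<sigma>: "\<And>j. j \<in> {1..m} \<Longrightarrow> \<sigma> j permutes {1..n j}"
      by (auto simp: G_def)
    \<comment> \<open>The chosen summands are the original arguments permuted within the blocks, so
      the symmetry of \<open>T\<close> applies.\<close>
    have "(\<lambda>v. if v \<in> ?V then x (fst v) (f v) else X v) = (\<lambda>(j, k)\<in>?V. X (j, \<sigma> j k))"
      using permutes_in_image[OF \<sigma>] by (fastforce simp: f X_def blockwise_def var_index_def fun_eq_iff)
    then show ?thesis using T_sym[OF X \<sigma>] by (simp add: a_def)
  qed
  have card_G: "card (blockwise m n ` G) = (\<Prod>j=1..m. fact (n j))"
    by (simp add: card_image[OF inj_on_blockwise[of m n, folded G_def]])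
      (simp add: G_def card_PiE card_permutations)
  let ?P = "2 ^ (\<Sum>j=1..m. n j) * (\<Prod>j=1..m. fact (n j)) :: complex"
  have pow_K: "2 ^ N \<in> K" for N :: nat
    using assms(1) by auto
  \<comment> \<open>The constant and its inverse are real, hence scalars for both choices of
    \<open>K\<close>; this permits the final cancellation.\<close>
  have P: "?P \<in> K" "1 / ?P \<in> K" "?P \<noteq> 0"
    using assms(1) by (auto simp: prod_in_Reals fact_in_Reals)
  have "(\<Oplus>\<^bsub>F\<^esub>\<epsilon>\<in>S. s \<epsilon> \<odot>\<^bsub>F\<^esub>
        T (\<lambda>(j, _)\<in>?V. x j 0 \<oplus>\<^bsub>E j\<^esub> (\<Oplus>\<^bsub>E j\<^esub>i\<in>{1..n j}. \<epsilon> (j, i) \<odot>\<^bsub>E j\<^esub> x j i))) =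
      (\<Oplus>\<^bsub>F\<^esub>\<epsilon>\<in>S. \<Oplus>\<^bsub>F\<^esub>f\<in>A. (s \<epsilon> * C \<epsilon> f) \<odot>\<^bsub>F\<^esub> a f)"
  proof (rule F.M.finsum_cong'[OF refl])
    fix \<epsilon> assume \<epsilon>: "\<epsilon> \<in> S"
    have "s \<epsilon> \<odot>\<^bsub>F\<^esub> (\<Oplus>\<^bsub>F\<^esub>f\<in>A. C \<epsilon> f \<odot>\<^bsub>F\<^esub> a f) = (\<Oplus>\<^bsub>F\<^esub>f\<in>A. s \<epsilon> \<odot>\<^bsub>F\<^esub> (C \<epsilon> f \<odot>\<^bsub>F\<^esub> a f))"
      using fin sK[OF \<epsilon>] CK[OF \<epsilon>] aF F.smult_closed by (intro F.finsum_smult_ldistr) auto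
    also have "\<dots> = (\<Oplus>\<^bsub>F\<^esub>f\<in>A. (s \<epsilon> * C \<epsilon> f) \<odot>\<^bsub>F\<^esub> a f)"
      using sK[OF \<epsilon>] CK[OF \<epsilon>] sCK[OF \<epsilon>] aF F.smult_closed F.smult_assoc1
      by (intro F.M.finsum_cong') auto
    finally show "s \<epsilon> \<odot>\<^bsub>F\<^esub>
        T (\<lambda>(j, _)\<in>?V. x j 0 \<oplus>\<^bsub>E j\<^esub> (\<Oplus>\<^bsub>E j\<^esub>i\<in>{1..n j}. \<epsilon> (j, i) \<odot>\<^bsub>E j\<^esub> x j i)) =
      (\<Oplus>\<^bsub>F\<^esub>f\<in>A. (s \<epsilon> * C \<epsilon> f) \<odot>\<^bsub>F\<^esub> a f)"
      by (simp only: expand[OF \<epsilon>])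
  qed (use sCK aF F.smult_closed in \<open>auto intro!: F.M.finsum_closed\<close>)
  \<comment> \<open>Since \<open>a f\<close> does not depend on the signs, summing over them first
    isolates the scalar coefficient computed in \<open>coeff\<close>.\<close>
  also have "\<dots> = (\<Oplus>\<^bsub>F\<^esub>f\<in>A. \<Oplus>\<^bsub>F\<^esub>\<epsilon>\<in>S. (s \<epsilon> * C \<epsilon> f) \<odot>\<^bsub>F\<^esub> a f)"
    using fin sCK aF F.smult_closed by (intro F.M.finsum_swap) auto
  also have "\<dots> = (\<Oplus>\<^bsub>F\<^esub>f\<in>A. (\<Sum>\<epsilon>\<in>S. s \<epsilon> * C \<epsilon> f) \<odot>\<^bsub>F\<^esub> a f)"
    using fin sCK aF F.smult_closed F.sum_scalar_closed[of S]
    by (intro F.M.finsum_cong' F.finsum_smult_rdistr) auto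
  \<comment> \<open>Choices that are not blockwise permutations have coefficient 0 and drop out; the
    remaining terms are all equal, and \<open>card_G\<close> counts them.\<close>
  also have "\<dots> = (\<Oplus>\<^bsub>F\<^esub>f\<in>blockwise m n ` G. 2 ^ (\<Sum>j=1..m. n j) \<odot>\<^bsub>F\<^esub> T X)"
    using fin GA coeff a_blockwise aF sCK F.smult_closed F.smult_l_null TX pow_K
    by (intro F.M.add.finprod_mono_neutral_cong_right) (auto simp del: One_nat_def)
  also have "\<dots> = ?P \<odot>\<^bsub>F\<^esub> T X"
    using fin TX assms(1) card_G
    by (subst F.finsum_smult_rdistr) (auto simp: mult.commute)
  finally have "(1 / ?P) \<odot>\<^bsub>F\<^esub> (\<Oplus>\<^bsub>F\<^esub>\<epsilon>\<in>S. s \<epsilon> \<odot>\<^bsub>F\<^esub>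
        T (\<lambda>(j, _)\<in>?V. x j 0 \<oplus>\<^bsub>E j\<^esub> (\<Oplus>\<^bsub>E j\<^esub>i\<in>{1..n j}. \<epsilon> (j, i) \<odot>\<^bsub>E j\<^esub> x j i))) =
      (1 / ?P) \<odot>\<^bsub>F\<^esub> (?P \<odot>\<^bsub>F\<^esub> T X)"
    by simp
  also have "\<dots> = T X"
    using F.smult_assoc1[of "1 / ?P" ?P "T X"] F.smult_one[of "T X"] P TX by simp
  finally show ?thesis
    unfolding s_eq S_def X_def by (rule sym)
qed

end
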